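(* Let $M\subset E^n$ be a helix hypersurface with respect to a fixed unit direction $d$, and let $\alpha: I\subset\mathbb{R}\to M$ be a curve on $M$ with tangent vector field $T$. If $\alpha$ is a line of curvature on $M$, then $d\in \mathrm{Sp}\{T\}^{\perp}$ along $\alpha$, i.e. $\langle T,d\rangle=0$ at every point of $\alpha$.
   Context: $E^n$ is $\mathbb{R}^n$ with the standard scalar product $\langle\cdot,\cdot\rangle$. Helix hypersurface: a hypersurface $M\subset\mathbb{R}^n$ is a helix with respect to a fixed unit vector $d\in\mathbb{R}^n$ if the angle between $d$ and the tangent space $T_qM$ is the same for every $q\in M$; equivalently, $\langle d,N\rangle$ is constant along $M$, where $N$ is a unit normal vector field on $M$. The shape operator of $M$ is $S(X)=D_XN$ for tangent vectors $X$, where $D$ is the standard covariant derivative of $E^n$. A curve $\alpha$ on $M$ with tangent vector field $T$ is a line of curvature if $(N\circ\alpha)'=S(T)=\lambda T$ along $\alpha$ for some scalar function $\lambda$. $\mathrm{Sp}\{T\}^{\perp}$ denotes the orthogonal complement of the span of $T$.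
   Formalization: The formal theorem also assumes that the scalar function λ in S(T)=λT vanishes nowhere along α; without this the claim is false, e.g. for a straight line in direction d on a hyperplane containing d. *)

theory Defs
  imports "HOL-Analysis.Analysis"
begin

primrec Ck_on ::
  "nat \<Rightarrow> 'a::euclidean_space set \<Rightarrow> ('a \<Rightarrow> 'b::euclidean_space) \<Rightarrow> bool"
where
  "Ck_on 0 U f \<longleftrightarrow> continuous_on U f"
| "Ck_on (Suc k) U f \<longleftrightarrow>
     (\<forall>x\<in>U. f differentiable (at x)) \<and>
     (\<forall>v. Ck_on k U (\<lambda>x. frechet_derivative f (at x) v))"

text \<open>
  On an arbitrary set, such as a hypersurface or a non-open interval, a map is
  smooth if near every point of the set it extends to a
  \<open>C\<^sup>\<infinity>\<close> map on an open set.
\<close>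

definition smooth_on ::
  "'a::euclidean_space set \<Rightarrow> ('a \<Rightarrow> 'b::euclidean_space) \<Rightarrow> bool"
where
  "smooth_on S f \<longleftrightarrow>
     (\<forall>x\<in>S. \<exists>U F. open U \<and> x \<in> U \<and> (\<forall>k. Ck_on k U F) \<and> (\<forall>y\<in>S \<inter> U. F y = f y))"

definition local_equation ::
  "(real^'n) set \<Rightarrow> real^'n \<Rightarrow> (real^'n) set \<Rightarrow> (real^'n \<Rightarrow> real) \<Rightarrow> bool"
where
  "local_equation M p U g \<longleftrightarrow>
     open U \<and> p \<in> U \<and> (\<forall>k. Ck_on k U g) \<and> M \<inter> U = {x\<in>U. g x = 0} \<and>
     (\<forall>x\<in>M \<inter> U. \<exists>v. frechet_derivative g (at x) v \<noteq> 0)"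

definition hypersurface :: "(real^'n) set \<Rightarrow> bool" where
  "hypersurface M \<longleftrightarrow> (\<forall>p\<in>M. \<exists>U g. local_equation M p U g)"

text \<open>
  The tangent space is the kernel of the differential of a local equation; for a
  hypersurface it does not depend on the local equation.
\<close>

definition tangent_space :: "(real^'n) set \<Rightarrow> real^'n \<Rightarrow> (real^'n) set" where
  "tangent_space M p =
     {v. \<exists>U g. local_equation M p U g \<and> frechet_derivative g (at p) v = 0}"

definition unit_normal_field :: "(real^'n) set \<Rightarrow> (real^'n \<Rightarrow> real^'n) \<Rightarrow> bool" where
  "unit_normal_field M N \<longleftrightarrow>
     smooth_on M N \<and> (\<forall>p\<in>M. norm (N p) = 1 \<and> N p \<in> (tangent_space M p)\<^sup>\<bottom>)"

text \<open>
  The angle between a vector \<open>d\<close> and a linear subspace \<open>W\<close> is the angle between \<open>d\<close>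
  and its orthogonal projection \<open>closest_point W d\<close>, and \<open>pi / 2\<close> if the projection is
  zero; its cosine is the quotient of the two norms.
\<close>

definition angle_with_subspace :: "'a::euclidean_space \<Rightarrow> 'a set \<Rightarrow> real" where
  "angle_with_subspace d W = arccos (norm (closest_point W d) / norm d)"

definition helix_hypersurface :: "(real^'n) set \<Rightarrow> real^'n \<Rightarrow> bool" where
  "helix_hypersurface M d \<longleftrightarrow>
     hypersurface M \<and> norm d = 1 \<and>
     (\<exists>\<theta>. \<forall>q\<in>M. angle_with_subspace d (tangent_space M q) = \<theta>)"

text \<open>
  The covariant derivative \<open>D\<^sub>X N\<close> is the derivative of \<open>N\<close> at \<open>p\<close> along \<open>M\<close>, in
  direction \<open>X\<close>. The filter \<open>at p within M\<close> determines it only for \<open>X\<close> tangent to \<open>M\<close>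
  at \<open>p\<close>, so the shape operator is meaningful only on the tangent space.
\<close>

definition shape_operator ::
  "(real^'n) set \<Rightarrow> (real^'n \<Rightarrow> real^'n) \<Rightarrow> real^'n \<Rightarrow> real^'n \<Rightarrow> real^'n"
where
  "shape_operator M N p X = frechet_derivative N (at p within M) X"

definition curve_on :: "(real^'n) set \<Rightarrow> real set \<Rightarrow> (real \<Rightarrow> real^'n) \<Rightarrow> bool" where
  "curve_on M I \<alpha> \<longleftrightarrow>
     is_interval I \<and> interior I \<noteq> {} \<and> smooth_on I \<alpha> \<and> \<alpha> ` I \<subseteq> M"

definition tangent_field :: "real set \<Rightarrow> (real \<Rightarrow> real^'n) \<Rightarrow> real \<Rightarrow> real^'n" where
  "tangent_field I \<alpha> t = vector_derivative \<alpha> (at t within I)"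

text \<open>
  The scalar factor \<open>\<kappa>\<close> in \<open>S(T) = \<kappa> T\<close> is a parameter, so that its zeros can be
  excluded; \<open>(N \<circ> \<alpha>)' = S(T)\<close> holds by the chain rule.
\<close>

definition line_of_curvature ::
  "(real^'n) set \<Rightarrow> (real^'n \<Rightarrow> real^'n) \<Rightarrow> real set \<Rightarrow> (real \<Rightarrow> real^'n) \<Rightarrow> (real \<Rightarrow> real) \<Rightarrow> bool"
where
  "line_of_curvature M N I \<alpha> \<kappa> \<longleftrightarrow>
     curve_on M I \<alpha> \<and>
     (\<forall>t\<in>I. shape_operator M N (\<alpha> t) (tangent_field I \<alpha> t) = \<kappa> t *\<^sub>R tangent_field I \<alpha> t)"

end

(*
  At every point the tangent space is the hyperplane orthogonal to N, so the projection of d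
  onto it has squared norm 1 - <d, N>^2; the helix condition therefore makes <d, N>^2 constant
  on M. Differentiating along the curve gives <d, (N o alpha)'> = 0, that is
  kappa * <d, T> = 0, and kappa does not vanish.
*)
theory Submission
  imports Defs
begin

lemma Ck_on_imp_differentiable:
  assumes "\<forall>k. Ck_on k U f" "x \<in> U"
  shows "f differentiable (at x)"
  using assms(1)[rule_format, of "Suc 0"] assms(2) by simp

text \<open>A derivative within \<open>S\<close> depends only on values in \<open>S\<close> near
  \<open>x\<close>, and there \<open>f\<close> agrees with a map that is differentiable in the full
  sense.\<close>

lemma smooth_on_imp_differentiable:
  assumes "smooth_on S f" "x \<in> S"
  shows "f differentiable (at x within S)"
proof -
  obtain U F where UF: "open U" "x \<in> U" "\<forall>k. Ck_on k U F" "\<forall>y\<in>S \<inter> U. F y = f y"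
    using assms unfolding smooth_on_def by blast
  have "F differentiable (at x)"
    using UF Ck_on_imp_differentiable by blast
  then have "F differentiable (at x within S)"
    by (rule differentiable_at_withinI)
  then obtain F' where "(F has_derivative F') (at x within S)"
    unfolding differentiable_def by blast
  moreover have "eventually (\<lambda>y. y \<in> U) (at x within S)"
    using UF by (metis eventually_at_topological)
  then have "eventually (\<lambda>y. F y = f y) (at x within S)"
    using UF(4) by (auto simp: eventually_at_filter elim!: eventually_mono)
  ultimately have "(f has_derivative F') (at x within S)"
    using UF assms(2) by (intro has_derivative_transform_eventually[of F F' x S f]) auto
  then show ?thesis
    unfolding differentiable_def by blast
qed

text \<open>The tangent space is defined as a union of kernels over all local equations. It lies in
  the hyperplane orthogonal to \<open>N p\<close> and contains the kernel of one nonzero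
  differential \<open>L\<close>, itself a hyperplane. Nested hyperplanes coincide, so all three sets
  are equal.\<close>

lemma tangent_space_eq_hyperplane:
  fixes M :: "(real^'n) set"
  assumes "hypersurface M" "unit_normal_field M N" "p \<in> M"
  shows "tangent_space M p = {v. N p \<bullet> v = 0}"
proof -
  obtain U g where eq: "local_equation M p U g"
    using assms unfolding hypersurface_def by blast
  define L where "L = frechet_derivative g (at p)"
  have "g differentiable (at p)"
    using eq Ck_on_imp_differentiable unfolding local_equation_def by blast
  then have L: "linear L"
    unfolding L_def by (rule linear_frechet_derivative)
  have "p \<in> M \<inter> U"
    using eq assms(3) unfolding local_equation_def by blast
  then obtain v where v: "L v \<noteq> 0"
    using eq unfolding local_equation_def L_def by blast
  have N: "norm (N p) = 1" "N p \<in> (tangent_space M p)\<^sup>\<bottom>"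
    using assms unfolding unit_normal_field_def by auto
  have tangent_normal: "N p \<bullet> x = 0" if "x \<in> tangent_space M p" for x
    using N(2) that by (auto simp: orthogonal_comp_def orthogonal_def inner_commute)
  have ker: "x \<in> tangent_space M p" if "L x = 0" for x
    using that eq unfolding tangent_space_def L_def by blast
  \<comment> \<open>The functionals \<open>L\<close> and \<open>N p \<bullet> _\<close> are
    proportional: the combination of \<open>x\<close> and \<open>v\<close> chosen below is killed by
    \<open>L\<close>, hence is orthogonal to \<open>N p\<close>.\<close>
  have *: "L v * (N p \<bullet> x) = L x * (N p \<bullet> v)" for x
  proof -
    have "L (L v *\<^sub>R x - L x *\<^sub>R v) = 0"
      using L by (simp add: linear_diff linear_cmul)
    from tangent_normal[OF ker[OF this]] show ?thesis
      by (simp add: inner_diff_right)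
  qed
  have "N p \<bullet> N p = 1"
    using N(1) by (simp add: dot_square_norm)
  \<comment> \<open>At \<open>x = N p\<close> the left side of \<open>*\<close> is
    \<open>L v\<close>, which is nonzero, so neither factor on the right vanishes.\<close>
  with *[of "N p"] v have "N p \<bullet> v \<noteq> 0"
    by auto
  then have "L x = 0" if "N p \<bullet> x = 0" for x
    using *[of x] that by auto
  then show ?thesis
    using tangent_normal ker by blast
qed

lemma closest_point_hyperplane:
  fixes n d :: "'a::euclidean_space"
  assumes "norm n = 1"
  shows "closest_point {v. n \<bullet> v = 0} d = d - (n \<bullet> d) *\<^sub>R n"
proof -
  have nn: "n \<bullet> n = 1"
    using assms by (simp add: dot_square_norm)
  have "dist d (d - (n \<bullet> d) *\<^sub>R n) \<le> dist d z" if "n \<bullet> z = 0" for z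
  proof -
    \<comment> \<open>For \<open>z\<close> in the hyperplane the left side is
      \<open>\<bar>n \<bullet> d\<bar>\<close>, the distance from \<open>d\<close> to the claimed
      foot point.\<close>
    have "\<bar>n \<bullet> (d - z)\<bar> \<le> norm n * norm (d - z)"
      by (rule Cauchy_Schwarz_ineq2)
    then show ?thesis
      using that assms by (simp add: dist_norm inner_diff_right)
  qed
  then show ?thesis
    using nn
    by (intro closest_point_unique[symmetric])
      (auto simp: convex_hyperplane closed_hyperplane inner_diff_right)
qed

lemma norm_closest_point_hyperplane:
  fixes n d :: "'a::euclidean_space"
  assumes "norm n = 1"
  shows "(norm (closest_point {v. n \<bullet> v = 0} d))\<^sup>2 = (norm d)\<^sup>2 - (n \<bullet> d)\<^sup>2"
proof -
  have "n \<bullet> n = 1"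
    using assms by (simp add: dot_square_norm)
  then show ?thesis
    unfolding closest_point_hyperplane[OF assms] power2_norm_eq_inner
    by (simp add: inner_diff_left inner_diff_right inner_commute power2_eq_square)
qed

text \<open>The angle fixes the length of the tangential part of \<open>d\<close>, hence by
  Pythagoras the normal part only up to sign. The sign may change between components of
  \<open>M\<close>, so the square is the right invariant.\<close>

lemma helix_hypersurface_inner_normal_square:
  fixes M :: "(real^'n) set"
  assumes "helix_hypersurface M d" "unit_normal_field M N" "p \<in> M" "q \<in> M"
  shows "(N p \<bullet> d)\<^sup>2 = (N q \<bullet> d)\<^sup>2"
proof -
  define P where "P x = norm (closest_point (tangent_space M x) d)" for x
  have d: "norm d = 1"
    using assms(1) unfolding helix_hypersurface_def by blast
  have sq: "(P x)\<^sup>2 = 1 - (N x \<bullet> d)\<^sup>2" if "x \<in> M" for x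
  proof -
    have "tangent_space M x = {v. N x \<bullet> v = 0}" "norm (N x) = 1"
      using assms tangent_space_eq_hyperplane that
      unfolding helix_hypersurface_def unit_normal_field_def by blast+
    then show ?thesis
      using norm_closest_point_hyperplane[of "N x" d] d by (simp add: P_def)
  qed
  have bounds: "0 \<le> P x" "P x \<le> 1" if "x \<in> M" for x
  proof -
    have "(P x)\<^sup>2 \<le> 1"
      using sq[OF that] by simp
    then show "P x \<le> 1"
      by (simp add: abs_square_le_1)
  qed (simp add: P_def)
  have "arccos (P p) = arccos (P q)"
    using assms d unfolding helix_hypersurface_def angle_with_subspace_def P_def by auto
  \<comment> \<open>\<open>arccos\<close> can be cancelled only for arguments in [-1, 1].\<close>
  moreover have "\<bar>P p\<bar> \<le> 1" "\<bar>P q\<bar> \<le> 1"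
    using bounds assms by auto
  ultimately have "P p = P q"
    using arccos_eq_iff by blast
  then show ?thesis
    using sq[OF assms(3)] sq[OF assms(4)] by simp
qed

text \<open>This is the chain rule (N o \<alpha>)' = S(T). Whichever derivative of \<open>N\<close>
  within \<open>M\<close> is selected, it gives the right value on T, because the curve stays in
  \<open>M\<close>.\<close>

lemma vector_derivative_along_curve:
  assumes "smooth_on M N" "curve_on M I \<alpha>" "t \<in> I"
  shows "((N \<circ> \<alpha>) has_vector_derivative
           shape_operator M N (\<alpha> t) (tangent_field I \<alpha> t)) (at t within I)"
proof -
  have sub: "\<alpha> ` I \<subseteq> M" and smooth: "smooth_on I \<alpha>"
    using assms(2) unfolding curve_on_def by auto
  have "(\<alpha> has_vector_derivative tangent_field I \<alpha> t) (at t within I)"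
    unfolding tangent_field_def
    using smooth_on_imp_differentiable[OF smooth assms(3)] by (simp add: vector_derivative_works)
  moreover have "(N has_derivative shape_operator M N (\<alpha> t)) (at (\<alpha> t) within M)"
    unfolding shape_operator_def[abs_def]
    using smooth_on_imp_differentiable[OF assms(1), of "\<alpha> t"] sub assms(3)
    by (simp add: frechet_derivative_works image_subset_iff)
  then have "(N has_derivative shape_operator M N (\<alpha> t)) (at (\<alpha> t) within \<alpha> ` I)"
    using sub by (rule has_derivative_subset)
  ultimately show ?thesis
    by (rule vector_derivative_diff_chain_within)
qed

lemma deriv_zero_of_constant_square:
  fixes f :: "real \<Rightarrow> real"
  assumes "(f has_real_derivative D) (at t within I)" "t \<in> I" "t islimpt I"
    and const: "\<And>s. s \<in> I \<Longrightarrow> (f s)\<^sup>2 = (f t)\<^sup>2"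
  shows "D = 0"
proof -
  have nontriv: "at t within I \<noteq> bot"
    using assms(3) by (simp add: trivial_limit_within)
  have const_deriv: "(g has_real_derivative 0) (at t within I)"
    if "\<And>s. s \<in> I \<Longrightarrow> g s = g t" for g :: "real \<Rightarrow> real"
    using has_derivative_transform[OF assms(2) that DERIV_const[unfolded has_field_derivative_def]]
    by (simp add: has_field_derivative_def)
  show ?thesis
  \<comment> \<open>Differentiating the square gives 2 f D = 0, which yields nothing at a zero of
    \<open>f\<close>. But if \<open>f t = 0\<close>, the constant square makes \<open>f\<close>
    vanish on all of \<open>I\<close>.\<close>
  proof (cases "f t = 0")
    case True
    have "(f has_real_derivative 0) (at t within I)"
      using True const by (intro const_deriv) auto
    then show ?thesis
      using assms(1) nontriv has_field_derivative_unique by blast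
  next
    case False
    have "((\<lambda>s. (f s)\<^sup>2) has_real_derivative 0) (at t within I)"
      using const by (rule const_deriv)
    moreover have "((\<lambda>s. (f s)\<^sup>2) has_real_derivative 2 * f t * D) (at t within I)"
      using assms(1) by (auto intro!: derivative_eq_intros)
    ultimately have "2 * f t * D = 0"
      using nontriv has_field_derivative_unique by blast
    with False show ?thesis
      by simp
  qed
qed

theorem theorem3p3:
  fixes M :: "(real^'n) set" and N :: "real^'n \<Rightarrow> real^'n" and d :: "real^'n"
    and I :: "real set" and \<alpha> :: "real \<Rightarrow> real^'n" and \<kappa> :: "real \<Rightarrow> real"
  assumes helix: "helix_hypersurface M d"
    and normal: "unit_normal_field M N"
    and line_of_curvature: "line_of_curvature M N I \<alpha> \<kappa>"
    and nonzero_curvature: "\<forall>t\<in>I. \<kappa> t \<noteq> 0"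
  shows "\<forall>t\<in>I. d \<in> (span {tangent_field I \<alpha> t})\<^sup>\<bottom>"
proof
  fix t assume t: "t \<in> I"
  define T where "T = tangent_field I \<alpha> t"
  have curve: "curve_on M I \<alpha>" and S: "shape_operator M N (\<alpha> t) T = \<kappa> t *\<^sub>R T"
    using line_of_curvature t unfolding line_of_curvature_def T_def by auto
  have "connected I" "interior I \<noteq> {}" and sub: "\<alpha> ` I \<subseteq> M"
    using curve unfolding curve_on_def by (auto simp: is_interval_connected)
  \<comment> \<open>A connected set with an isolated point is a singleton, which has empty interior
    in the reals. Thus every point of \<open>I\<close>, endpoints included, is a limit point, and
    one-sided derivatives there are unique.\<close>
  then have limpt: "t islimpt I"
    using t by (metis connected_imp_perfect interior_singleton)
  have "((N \<circ> \<alpha>) has_vector_derivative \<kappa> t *\<^sub>R T) (at t within I)"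
    using vector_derivative_along_curve[OF _ curve t, of N] normal S
    by (simp add: unit_normal_field_def T_def)
  then have "((\<lambda>s. N (\<alpha> s) \<bullet> d) has_vector_derivative (\<kappa> t *\<^sub>R T) \<bullet> d) (at t within I)"
    unfolding o_def by (rule bounded_linear.has_vector_derivative[OF bounded_linear_inner_left])
  then have "((\<lambda>s. N (\<alpha> s) \<bullet> d) has_real_derivative \<kappa> t * (T \<bullet> d)) (at t within I)"
    by (simp add: has_real_derivative_iff_has_vector_derivative)
  then have "\<kappa> t * (T \<bullet> d) = 0"
  proof (rule deriv_zero_of_constant_square[OF _ t limpt])
    show "(N (\<alpha> s) \<bullet> d)\<^sup>2 = (N (\<alpha> t) \<bullet> d)\<^sup>2" if "s \<in> I" for s
      using helix_hypersurface_inner_normal_square[OF helix normal] sub t that by blast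
  qed
  then have "T \<bullet> d = 0"
    using nonzero_curvature t by simp
  then show "d \<in> (span {tangent_field I \<alpha> t})\<^sup>\<bottom>"
    by (auto simp: orthogonal_comp_def orthogonal_def span_singleton T_def)
qed

end
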